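(* Let $\mathbf{J}=\mathbf{I}+\mathbf{R}$ be a real symmetric positive definite $N\times N$ matrix with $\mathrm{diag}(\mathbf{R})=\mathbf{0}$, and let $\mathbf{h}\in\mathbb{R}^N$. With $F_{MF}$, $F_\alpha$, $\sigma_{ij}^*(\alpha)$, $F^c_\alpha$ and $F_B$ as defined in the context, for every $\mathbf{m}\in\mathbb{R}^N$, every $\boldsymbol{\sigma}\in\mathbb{R}^N$ with all $\sigma_k>0$, every $0\le\alpha_1\le1$ and every $\alpha_2\ge1$, $$F_{MF}(\mathbf{m},\boldsymbol{\sigma})\ \ge\ F^c_{\alpha_1}(\mathbf{m},\boldsymbol{\sigma})\ \ge\ F_B(\mathbf{m},\{\sigma_{ij}^*\},\boldsymbol{\sigma}),$$ $$F_B(\mathbf{m},\{\sigma_{ij}^*\},\boldsymbol{\sigma})\ \ge\ F^c_{\alpha_2}(\mathbf{m},\boldsymbol{\sigma})\ \ge\ F_{MF}(\mathbf{m},\boldsymbol{\sigma})-\frac12\boldsymbol{\sigma}^T|\mathbf{R}|\boldsymbol{\sigma}.$$ Moreover, these bounds are tight, that is, $$\lim_{\alpha\to0}F_\alpha(\mathbf{m},\{\sigma_{ij}^*(\alpha)\},\boldsymbol{\sigma})=F_{MF}(\mathbf{m},\boldsymbol{\sigma})$$ and $$\lim_{\alpha\to\infty}F_\alpha(\mathbf{m},\{\sigma_{ij}^*(\alpha)\},\boldsymbol{\sigma})=F_{MF}(\mathbf{m},\boldsymbol{\sigma})-\frac12\boldsymbol{\sigma}^T|\mathbf{R}|\bo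ldsymbol{\sigma}.$$
   Context: Let $E=\{\{i,j\}: i\neq j,\ R_{ij}\ne0\}$ (sums over $E$ count each unordered edge once), and let $|\mathbf{R}|$ be the matrix with entries $|R_{ij}|$. Fix one constant $C$, common to all the functions below. Mean field free energy: for $\mathbf{m}\in\mathbb{R}^N$ and $\boldsymbol{\sigma}=(\sigma_1,\dots,\sigma_N)$ with all $\sigma_k>0$, $$F_{MF}(\mathbf{m},\boldsymbol{\sigma})=-\mathbf{h}^T\mathbf{m}+\frac12\mathbf{m}^T\mathbf{J}\mathbf{m}+\frac12\sum_k\sigma_k^2-\sum_k\log\sigma_k+C.$$ Fractional Bethe free energy, with all edge parameters equal to a single $\alpha>0$: for $|\sigma_{ij}|<\sigma_i\sigma_j$, $\{i,j\}\in E$, $$F_\alpha(\mathbf{m},\{\sigma_{ij}\},\boldsymbol{\sigma})=-\mathbf{h}^T\mathbf{m}+\frac12\mathbf{m}^T\mathbf{J}\mathbf{m}+\frac12\sum_k\sigma_k^2+\sum_{\{i,j\}\in E}R_{ij}\sigma_{ij}-\frac1{2\alpha}\sum_{\{i,j\}\in E}\log\Bigl(1-\frac{\sigma_{ij}^2}{\sigma_i^2\sigma_j^2}\Bigr)-\sum_k\log\sigma_k+C.$$ For $\{i,j\}\in E$ and $\alpha>0$, put $$\sigma_{ij}^*(\alpha)=-\mathrm{sign}(R_{ij})\,\frac{\bigl(1+(2\alpha R_{ij})^2\sigma_i^2\sigma_j^2\bigr)^{1/2}-1}{2\alpha|R_{ij}|}.$$ The constrained free energy is $F^c_\alpha(\mathbf{m},\boldsymbol{\sigma})=F_\alpha(\mathbf{m},\{\sigma^*_{ij}(\alpha)\},\boldsymbol{\sigma})$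 for $\alpha>0$, and $F^c_0(\mathbf{m},\boldsymbol{\sigma})=\lim_{\alpha\to0^+}F^c_\alpha(\mathbf{m},\boldsymbol{\sigma})$. The Bethe free energy is $F_B=F_1$ (the case $\alpha=1$), and in $F_B(\mathbf{m},\{\sigma_{ij}^*\},\boldsymbol{\sigma})$ one takes $\sigma_{ij}^*=\sigma_{ij}^*(1)$. *)

theory Defs
  imports "HOL-Analysis.Analysis"
begin

definition positive_definite :: "real^'n^'n \<Rightarrow> bool" where
  "positive_definite A \<longleftrightarrow> (\<forall>x. x \<noteq> 0 \<longrightarrow> x \<bullet> (A *v x) > 0)"

definition abs_matrix :: "real^'n^'n \<Rightarrow> real^'n^'n" where
  "abs_matrix R = (\<chi> i j. \<bar>R $ i $ j\<bar>)"

definition edges :: "real^'n^'n \<Rightarrow> 'n set set" where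
  "edges R = {{i, j} | i j. i \<noteq> j \<and> R $ i $ j \<noteq> 0}"

text \<open>
  Edges are two-element sets, so that a sum over \<^term>\<open>edges R\<close> counts each unordered edge once.
  The entry of a matrix at an edge is well defined when the matrix is symmetric;
  see \<open>edge_entry_eq\<close>. Products \<open>\<Prod>k\<in>e. \<dots>\<close> over an edge
  \<open>e = {i, j}\<close> are products of two factors.
\<close>

definition edge_entry :: "real^'n^'n \<Rightarrow> 'n set \<Rightarrow> real" where
  "edge_entry R e = (THE r. \<exists>i j. i \<noteq> j \<and> e = {i, j} \<and> r = R $ i $ j)"

lemma edge_entry_eq:
  assumes "transpose R = R" and "i \<noteq> j"
  shows "edge_entry R {i, j} = R $ i $ j"
proof -
  have sym: "R $ a $ b = R $ b $ a" for a b
    using assms(1) by (metis transpose_def vec_lambda_beta)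
  show ?thesis
    unfolding edge_entry_def
  proof (rule the_equality)
    show "\<exists>a b. a \<noteq> b \<and> {i, j} = {a, b} \<and> R $ i $ j = R $ a $ b"
      using assms(2) by blast
  next
    fix r assume "\<exists>a b. a \<noteq> b \<and> {i, j} = {a, b} \<and> r = R $ a $ b"
    then show "r = R $ i $ j"
      using sym by (auto simp: doubleton_eq_iff)
  qed
qed

definition mean_field_free_energy ::
  "real^'n \<Rightarrow> real^'n^'n \<Rightarrow> real \<Rightarrow> real^'n \<Rightarrow> real^'n \<Rightarrow> real" where
  "mean_field_free_energy h J C m \<sigma> =
     - (h \<bullet> m) + 1/2 * (m \<bullet> (J *v m)) + 1/2 * (\<Sum>k\<in>UNIV. (\<sigma> $ k)\<^sup>2)
     - (\<Sum>k\<in>UNIV. ln (\<sigma> $ k)) + C"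

text \<open>
  The argument \<open>s\<close> holds the covariances: \<open>s {i, j}\<close> is
  \<open>\<sigma>\<^bsub>ij\<^esub>\<close>. The value is meaningful only for
  \<open>\<bar>s e\<bar> < (\<Prod>k\<in>e. \<sigma> $ k)\<close> on all edges \<open>e\<close>, all entries of \<open>\<sigma>\<close> positive,
  and \<open>\<alpha> > 0\<close>; by \<open>abs_opt_cov_less\<close> the covariances used below satisfy the constraint.
\<close>

definition fractional_bethe_free_energy ::
  "real^'n \<Rightarrow> real^'n^'n \<Rightarrow> real^'n^'n \<Rightarrow> real \<Rightarrow> real
    \<Rightarrow> real^'n \<Rightarrow> ('n set \<Rightarrow> real) \<Rightarrow> real^'n \<Rightarrow> real" where
  "fractional_bethe_free_energy h J R C \<alpha> m s \<sigma> =
     - (h \<bullet> m) + 1/2 * (m \<bullet> (J *v m)) + 1/2 * (\<Sum>k\<in>UNIV. (\<sigma> $ k)\<^sup>2)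
     + (\<Sum>e\<in>edges R. edge_entry R e * s e)
     - 1 / (2 * \<alpha>) * (\<Sum>e\<in>edges R. ln (1 - (s e)\<^sup>2 / (\<Prod>k\<in>e. (\<sigma> $ k)\<^sup>2)))
     - (\<Sum>k\<in>UNIV. ln (\<sigma> $ k)) + C"

definition bethe_free_energy ::
  "real^'n \<Rightarrow> real^'n^'n \<Rightarrow> real^'n^'n \<Rightarrow> real
    \<Rightarrow> real^'n \<Rightarrow> ('n set \<Rightarrow> real) \<Rightarrow> real^'n \<Rightarrow> real" where
  "bethe_free_energy h J R C = fractional_bethe_free_energy h J R C 1"

definition opt_cov :: "real^'n^'n \<Rightarrow> real \<Rightarrow> real^'n \<Rightarrow> 'n set \<Rightarrow> real" where
  "opt_cov R \<alpha> \<sigma> e =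
     - sgn (edge_entry R e) *
     ((sqrt (1 + (2 * \<alpha> * edge_entry R e)\<^sup>2 * (\<Prod>k\<in>e. (\<sigma> $ k)\<^sup>2)) - 1)
       / (2 * \<alpha> * \<bar>edge_entry R e\<bar>))"

lemma abs_opt_cov_less:
  assumes "transpose R = R" and "e \<in> edges R" and "\<alpha> > 0" and "\<forall>k. \<sigma> $ k > 0"
  shows "\<bar>opt_cov R \<alpha> \<sigma> e\<bar> < (\<Prod>k\<in>e. \<sigma> $ k)"
proof -
  obtain i j where ij: "i \<noteq> j" "e = {i, j}" "R $ i $ j \<noteq> 0"
    using assms(2) by (auto simp: edges_def)
  define r where "r = edge_entry R e"
  define p where "p = (\<Prod>k\<in>e. \<sigma> $ k)"
  define t where "t = 2 * \<alpha> * \<bar>r\<bar>"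
  have r: "r \<noteq> 0" using ij edge_entry_eq[OF assms(1) ij(1)] by (simp add: r_def)
  have p: "p > 0" unfolding p_def using assms(4) by (intro prod_pos) auto
  have t: "t > 0" using r assms(3) by (simp add: t_def)
  have sq: "(2 * \<alpha> * r)\<^sup>2 * (\<Prod>k\<in>e. (\<sigma> $ k)\<^sup>2) = (t * p)\<^sup>2"
    by (simp add: t_def p_def power_mult_distrib prod_power_distrib)
  have ge: "sqrt (1 + (t * p)\<^sup>2) \<ge> 1" by simp
  have "sqrt (1 + (t * p)\<^sup>2) < 1 + t * p"
  proof (rule real_less_lsqrt)
    show "0 \<le> 1 + t * p" using t p by simp
    show "1 + (t * p)\<^sup>2 < (1 + t * p)\<^sup>2" using t p by (simp add: power2_sum)
  qed
  then have "(sqrt (1 + (t * p)\<^sup>2) - 1) / t < p"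
    using t by (simp add: pos_divide_less_eq algebra_simps)
  moreover have "\<bar>opt_cov R \<alpha> \<sigma> e\<bar> = (sqrt (1 + (t * p)\<^sup>2) - 1) / t"
    using r t ge unfolding opt_cov_def r_def[symmetric] sq t_def[symmetric]
    by (simp add: abs_mult abs_sgn_eq)
  ultimately show ?thesis by (simp add: p_def)
qed

text \<open>
  At \<open>\<alpha> = 0\<close> the value is the right-hand limit at zero. As \<^term>\<open>Lim\<close> is a definite
  description, this is informative only if the limit exists.
\<close>

definition constrained_free_energy ::
  "real^'n \<Rightarrow> real^'n^'n \<Rightarrow> real^'n^'n \<Rightarrow> real \<Rightarrow> real
    \<Rightarrow> real^'n \<Rightarrow> real^'n \<Rightarrow> real" where
  "constrained_free_energy h J R C \<alpha> m \<sigma> =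
     (if \<alpha> = 0
      then Lim (at_right 0)
             (\<lambda>a. fractional_bethe_free_energy h J R C a m (opt_cov R a \<sigma>) \<sigma>)
      else fractional_bethe_free_energy h J R C \<alpha> m (opt_cov R \<alpha> \<sigma>) \<sigma>)"

end

(*
Up to sign, an edge {i,j} with q = |R_ij| sigma_i sigma_j contributes q G(2 alpha q) to the
constrained free energy, where G(x) = (w - 1 - ln ((w + 1) / 2)) / x and w = sqrt (1 + x^2).
The function G increases from 0 at 0 to 1 at infinity, and the weights q sum to
sigma^T |R| sigma / 2. Monotonicity comes from d/dx (x G(x)) = x / (w + 1), which gives
G'(x) = ln ((w + 1) / 2) / x^2.
*)

theory Submission
  imports Defs "HOL-Real_Asymp.Real_Asymp"
begin

definition edge_gain :: "real \<Rightarrow> real" where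
  "edge_gain x = (sqrt (1 + x\<^sup>2) - 1 - ln ((sqrt (1 + x\<^sup>2) + 1) / 2)) / x"

text \<open>With w as in the overview, w - 1 behaves like x^2/2 and the logarithm like x^2/4 near 0,
  so the quotient behaves like x/4.\<close>

lemma edge_gain_tendsto_0: "(edge_gain \<longlongrightarrow> 0) (at_right 0)"
  unfolding edge_gain_def by real_asymp

text \<open>At infinity w behaves like x, while the logarithm is of smaller order.\<close>

lemma edge_gain_tendsto_1: "(edge_gain \<longlongrightarrow> 1) at_top"
  unfolding edge_gain_def by real_asymp

text \<open>Applying ln t \<le> t - 1 at t = (w + 1)/2 bounds the logarithm by (w - 1)/2, which is
  at most w - 1.\<close>

lemma edge_gain_nonneg:
  assumes "x > 0"
  shows "edge_gain x \<ge> 0"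
proof -
  define w where "w = sqrt (1 + x\<^sup>2)"
  have w: "w \<ge> 1" by (simp add: w_def)
  then have "ln ((w + 1) / 2) \<le> (w + 1) / 2 - 1"
    by (intro ln_le_minus_one) simp
  also have "\<dots> \<le> w - 1" using w by (simp add: field_simps)
  finally show ?thesis using assms by (simp add: edge_gain_def w_def)
qed

lemma edge_gain_le_1:
  assumes "x > 0"
  shows "edge_gain x \<le> 1"
proof -
  have "sqrt (1 + x\<^sup>2) \<le> 1 + x"
    using assms by (intro real_le_lsqrt) (auto simp: power2_sum)
  moreover have "ln ((sqrt (1 + x\<^sup>2) + 1) / 2) \<ge> 0" by simp
  ultimately have "sqrt (1 + x\<^sup>2) - 1 - ln ((sqrt (1 + x\<^sup>2) + 1) / 2) \<le> x"
    by linarith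
  then show ?thesis using assms by (simp add: edge_gain_def)
qed

lemma edge_gain_has_real_derivative:
  assumes "x > 0"
  shows "(edge_gain has_real_derivative ln ((sqrt (1 + x\<^sup>2) + 1) / 2) / x\<^sup>2) (at x)"
proof -
  define w where "w = sqrt (1 + x\<^sup>2)"
  have pos: "1 + x\<^sup>2 > 0" by (simp add: add_pos_nonneg)
  have w: "w \<ge> 1" "w\<^sup>2 = 1 + x\<^sup>2" by (auto simp: w_def)
  have dw: "((\<lambda>x. sqrt (1 + x\<^sup>2)) has_real_derivative x / w) (at x)"
    using pos unfolding w_def by (auto intro!: derivative_eq_intros simp: field_simps)
  have "((\<lambda>x. sqrt (1 + x\<^sup>2) - 1 - ln ((sqrt (1 + x\<^sup>2) + 1) / 2)) has_real_derivative
      x / w - x / w / (w + 1)) (at x)"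
    using w(1) pos
    by (auto intro!: derivative_eq_intros dw simp: w_def[symmetric] field_simps)
  also have "x / w - x / w / (w + 1) = x / (w + 1)"
  proof -
    have "w > 0" "w + w * w > 0" using w(1) by (simp_all add: add_pos_pos)
    then show ?thesis by (simp add: field_simps)
  qed
  finally have dH: "((\<lambda>x. sqrt (1 + x\<^sup>2) - 1 - ln ((sqrt (1 + x\<^sup>2) + 1) / 2))
      has_real_derivative x / (w + 1)) (at x)" .
  \<comment> \<open>Since x^2 = (w - 1)(w + 1), the terms w - 1 in the numerator of the quotient
    rule cancel and only the logarithm survives.\<close>
  have "x / (w + 1) * x = w - 1"
    using w by (simp add: field_simps power2_eq_square)
  then have "(x / (w + 1) * x - (w - 1 - ln ((w + 1) / 2)) * 1) / (x * x)
      = ln ((w + 1) / 2) / x\<^sup>2"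
    by (simp add: power2_eq_square)
  then show ?thesis
    using DERIV_divide[OF dH DERIV_ident] assms
    unfolding edge_gain_def [abs_def] w_def by simp
qed

lemma edge_gain_mono:
  assumes "0 < x" and "x \<le> y"
  shows "edge_gain x \<le> edge_gain y"
proof (rule DERIV_nonneg_imp_nondecreasing[OF assms(2)])
  fix z assume z: "x \<le> z" "z \<le> y"
  have "ln ((sqrt (1 + z\<^sup>2) + 1) / 2) / z\<^sup>2 \<ge> 0" by simp
  then show "\<exists>d. (edge_gain has_real_derivative d) (at z) \<and> 0 \<le> d"
    using edge_gain_has_real_derivative z assms(1) by (meson less_le_trans)
qed

text \<open>Here p stands for the product of the two standard deviations on an edge. In terms of x =
  2 \<alpha> |r| p and w = sqrt (1 + x^2), the covariance satisfies |s|/p = (w - 1)/x. Its sign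
  makes r s negative, and x^2 = (w - 1)(w + 1) makes the argument of the logarithm rational in
  w.\<close>

lemma edge_term_eq:
  fixes r p \<alpha> :: real
  assumes "r \<noteq> 0" and "p > 0" and "\<alpha> > 0"
  defines "s \<equiv> - sgn r * ((sqrt (1 + (2 * \<alpha> * r)\<^sup>2 * p\<^sup>2) - 1) / (2 * \<alpha> * \<bar>r\<bar>))"
  shows "r * s - 1 / (2 * \<alpha>) * ln (1 - s\<^sup>2 / p\<^sup>2)
      = - (\<bar>r\<bar> * p * edge_gain (2 * \<alpha> * (\<bar>r\<bar> * p)))"
proof -
  define x where "x = 2 * \<alpha> * (\<bar>r\<bar> * p)"
  define w where "w = sqrt (1 + x\<^sup>2)"
  have x: "x > 0" using assms by (simp add: x_def)
  \<comment> \<open>Strictness is what permits cancelling the factor w - 1 below.\<close>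
  have w: "w > 1" "w\<^sup>2 = 1 + x\<^sup>2" using x by (auto simp: w_def)
  have "(2 * \<alpha> * r)\<^sup>2 * p\<^sup>2 = x\<^sup>2" by (simp add: x_def power_mult_distrib)
  then have s: "s = - sgn r * ((w - 1) / (2 * \<alpha> * \<bar>r\<bar>))"
    by (simp add: s_def w_def)
  have rs: "r * s = - ((w - 1) / (2 * \<alpha>))"
    using assms(1,3) unfolding s by (simp add: sgn_if field_simps)
  have "s\<^sup>2 / p\<^sup>2 = (w - 1)\<^sup>2 / x\<^sup>2"
    using assms(1) unfolding s by (simp add: x_def power_mult_distrib power_divide sgn_if)
  also have "x\<^sup>2 = (w - 1) * (w + 1)"
    using w(2) by (simp add: algebra_simps power2_eq_square)
  also have "(w - 1)\<^sup>2 / ((w - 1) * (w + 1)) = (w - 1) / (w + 1)"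
    using w(1) by (simp add: power2_eq_square)
  \<comment> \<open>The value 2/(w + 1) is written as an inverse so that its logarithm is minus the
    one in \<open>edge_gain\<close>.\<close>
  finally have "1 - s\<^sup>2 / p\<^sup>2 = inverse ((w + 1) / 2)"
    using w(1) by (simp add: field_simps)
  then have ln: "ln (1 - s\<^sup>2 / p\<^sup>2) = - ln ((w + 1) / 2)"
    using w(1) by (simp only: ln_inverse)
  \<comment> \<open>The prefactor |r| p cancels against the denominator x, leaving 1/(2
    \<alpha>).\<close>
  have "\<bar>r\<bar> * p * edge_gain x = (w - 1 - ln ((w + 1) / 2)) / (2 * \<alpha>)"
    using assms(1-3) unfolding edge_gain_def w_def[symmetric] by (simp add: x_def)
  then show ?thesis
    unfolding rs ln x_def[symmetric] by (simp add: diff_divide_distrib)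
qed

definition edge_weight :: "real^'n^'n \<Rightarrow> real^'n \<Rightarrow> 'n set \<Rightarrow> real" where
  "edge_weight R \<sigma> e = \<bar>edge_entry R e\<bar> * (\<Prod>k\<in>e. \<sigma> $ k)"

lemma edge_entry_nonzero:
  assumes "transpose R = R" and "e \<in> edges R"
  shows "edge_entry R e \<noteq> 0"
  using assms edge_entry_eq[OF assms(1)] by (auto simp: edges_def)

lemma edge_weight_pos:
  assumes "transpose R = R" and "e \<in> edges R" and "\<forall>k. \<sigma> $ k > 0"
  shows "edge_weight R \<sigma> e > 0"
  unfolding edge_weight_def
  using edge_entry_nonzero[OF assms(1,2)] assms(3) by (intro mult_pos_pos prod_pos) auto

text \<open>The two energies differ only in their edge terms, which \<open>edge_term_eq\<close>
  evaluates one edge at a time. All claims about the energies thereby become claims about a finite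
  sum of values of \<open>edge_gain\<close>.\<close>

lemma fractional_bethe_free_energy_opt_cov:
  assumes "transpose R = R" and "\<forall>k. \<sigma> $ k > 0" and "\<alpha> > 0"
  shows "fractional_bethe_free_energy h J R C \<alpha> m (opt_cov R \<alpha> \<sigma>) \<sigma>
      = mean_field_free_energy h J C m \<sigma>
        - (\<Sum>e\<in>edges R. edge_weight R \<sigma> e * edge_gain (2 * \<alpha> * edge_weight R \<sigma> e))"
proof -
  let ?s = "opt_cov R \<alpha> \<sigma>"
  have "edge_entry R e * ?s e
        - 1 / (2 * \<alpha>) * ln (1 - (?s e)\<^sup>2 / (\<Prod>k\<in>e. (\<sigma> $ k)\<^sup>2))
      = - (edge_weight R \<sigma> e * edge_gain (2 * \<alpha> * edge_weight R \<sigma> e))"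
    if "e \<in> edges R" for e
  proof -
    have "(\<Prod>k\<in>e. \<sigma> $ k) > 0" using assms(2) by (intro prod_pos) auto
    from edge_term_eq[OF edge_entry_nonzero[OF assms(1) that] this assms(3)]
    show ?thesis
      unfolding opt_cov_def edge_weight_def prod_power_distrib .
  qed
  then have "(\<Sum>e\<in>edges R. edge_entry R e * ?s e)
      - 1 / (2 * \<alpha>) * (\<Sum>e\<in>edges R. ln (1 - (?s e)\<^sup>2 / (\<Prod>k\<in>e. (\<sigma> $ k)\<^sup>2)))
      = - (\<Sum>e\<in>edges R. edge_weight R \<sigma> e * edge_gain (2 * \<alpha> * edge_weight R \<sigma> e))"
    by (simp add: sum_distrib_left flip: sum_subtractf sum_negf)
  then show ?thesis
    unfolding fractional_bethe_free_energy_def mean_field_free_energy_def by linarith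
qed

text \<open>Group the ordered pairs by their underlying set. By symmetry of R the fibre over an edge
  {i, j} is {(i, j), (j, i)}, and these two pairs are distinct because i differs from j.\<close>

lemma sum_edges:
  fixes R :: "real^'n^'n" and f :: "'n set \<Rightarrow> real"
  assumes "transpose R = R"
  shows "(\<Sum>(i, j)\<in>{(i, j). i \<noteq> j \<and> R $ i $ j \<noteq> 0}. f {i, j}) = 2 * (\<Sum>e\<in>edges R. f e)"
proof -
  have sym: "R $ a $ b = R $ b $ a" for a b
    using assms by (metis transpose_def vec_lambda_beta)
  let ?P = "{(i, j). i \<noteq> j \<and> R $ i $ j \<noteq> 0}"
  let ?g = "\<lambda>(i, j). {i, j} :: 'n set"
  have "(\<Sum>x\<in>?P. f (?g x)) = (\<Sum>e\<in>?g ` ?P. \<Sum>x\<in>{x \<in> ?P. ?g x = e}. f (?g x))"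
    by (rule sum.image_gen) simp
  also have "?g ` ?P = edges R"
    by (auto simp: edges_def image_iff)
  also have "(\<Sum>e\<in>edges R. \<Sum>x\<in>{x \<in> ?P. ?g x = e}. f (?g x)) = (\<Sum>e\<in>edges R. 2 * f e)"
  proof (rule sum.cong[OF refl])
    fix e assume "e \<in> edges R"
    then obtain i j where ij: "i \<noteq> j" "e = {i, j}" "R $ i $ j \<noteq> 0"
      by (auto simp: edges_def)
    have "{x \<in> ?P. ?g x = e} = {(i, j), (j, i)}"
      using ij sym[of i j] by (auto simp: doubleton_eq_iff)
    then show "(\<Sum>x\<in>{x \<in> ?P. ?g x = e}. f (?g x)) = 2 * f e"
      using ij by (simp add: insert_commute)
  qed
  finally show ?thesis
    by (simp add: sum_distrib_left case_prod_unfold)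
qed

text \<open>The quadratic form sums over all ordered pairs. The diagonal and the zero entries
  contribute nothing, and every edge appears in both orientations, whence the factor 1/2.\<close>

lemma sum_edge_weight:
  fixes R :: "real^'n^'n"
  assumes "transpose R = R" and "\<forall>i. R $ i $ i = 0"
  shows "(\<Sum>e\<in>edges R. edge_weight R \<sigma> e) = 1/2 * (\<sigma> \<bullet> (abs_matrix R *v \<sigma>))"
proof -
  let ?P = "{(i, j). i \<noteq> j \<and> R $ i $ j \<noteq> 0}"
  have "\<sigma> \<bullet> (abs_matrix R *v \<sigma>)
      = (\<Sum>(i, j)\<in>UNIV. \<sigma> $ i * (\<bar>R $ i $ j\<bar> * \<sigma> $ j))"
    by (simp add: inner_vec_def matrix_vector_mult_def abs_matrix_def sum_distrib_left
        sum.cartesian_product)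
  also have "\<dots> = (\<Sum>(i, j)\<in>?P. \<sigma> $ i * (\<bar>R $ i $ j\<bar> * \<sigma> $ j))"
    using assms(2) by (intro sum.mono_neutral_right) auto
  also have "\<dots> = (\<Sum>(i, j)\<in>?P. edge_weight R \<sigma> {i, j})"
    by (intro sum.cong) (auto simp: edge_weight_def edge_entry_eq[OF assms(1)])
  also have "\<dots> = 2 * (\<Sum>e\<in>edges R. edge_weight R \<sigma> e)"
    by (rule sum_edges[OF assms(1)])
  finally show ?thesis by simp
qed

theorem mainTheorem2:
  fixes J R :: "real^'n^'n" and h m \<sigma> :: "real^'n" and C :: real
  assumes "J = mat 1 + R"
    and "transpose J = J"
    and "positive_definite J"
    and "\<forall>i. R $ i $ i = 0"
    and "\<forall>k. \<sigma> $ k > 0"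
  shows "(\<forall>\<alpha>\<^sub>1. 0 \<le> \<alpha>\<^sub>1 \<and> \<alpha>\<^sub>1 \<le> 1 \<longrightarrow>
            mean_field_free_energy h J C m \<sigma> \<ge> constrained_free_energy h J R C \<alpha>\<^sub>1 m \<sigma> \<and>
            constrained_free_energy h J R C \<alpha>\<^sub>1 m \<sigma> \<ge> bethe_free_energy h J R C m (opt_cov R 1 \<sigma>) \<sigma>)
       \<and> (\<forall>\<alpha>\<^sub>2. \<alpha>\<^sub>2 \<ge> 1 \<longrightarrow>
            bethe_free_energy h J R C m (opt_cov R 1 \<sigma>) \<sigma> \<ge> constrained_free_energy h J R C \<alpha>\<^sub>2 m \<sigma> \<and>
            constrained_free_energy h J R C \<alpha>\<^sub>2 m \<sigma>
              \<ge> mean_field_free_energy h J C m \<sigma> - 1/2 * (\<sigma> \<bullet> (abs_matrix R *v \<sigma>)))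
       \<and> ((\<lambda>\<alpha>. fractional_bethe_free_energy h J R C \<alpha> m (opt_cov R \<alpha> \<sigma>) \<sigma>)
            \<longlongrightarrow> mean_field_free_energy h J C m \<sigma>) (at_right 0)
       \<and> ((\<lambda>\<alpha>. fractional_bethe_free_energy h J R C \<alpha> m (opt_cov R \<alpha> \<sigma>) \<sigma>)
            \<longlongrightarrow> mean_field_free_energy h J C m \<sigma> - 1/2 * (\<sigma> \<bullet> (abs_matrix R *v \<sigma>))) at_top"
proof -
  let ?MF = "mean_field_free_energy h J C m \<sigma>"
  let ?F = "\<lambda>\<alpha>. fractional_bethe_free_energy h J R C \<alpha> m (opt_cov R \<alpha> \<sigma>) \<sigma>"
  let ?q = "edge_weight R \<sigma>"
  let ?S = "\<lambda>\<alpha>. \<Sum>e\<in>edges R. ?q e * edge_gain (2 * \<alpha> * ?q e)"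
  have "R = J - mat 1" using assms(1) by simp
  then have sym: "transpose R = R"
    using assms(2) by (simp add: transpose_def vec_eq_iff mat_def)
  have F: "?F \<alpha> = ?MF - ?S \<alpha>" if "\<alpha> > 0" for \<alpha>
    by (rule fractional_bethe_free_energy_opt_cov[OF sym assms(5) that])
  have q: "?q e > 0" if "e \<in> edges R" for e
    by (rule edge_weight_pos[OF sym that assms(5)])
  have total: "(\<Sum>e\<in>edges R. ?q e) = 1/2 * (\<sigma> \<bullet> (abs_matrix R *v \<sigma>))"
    by (rule sum_edge_weight[OF sym assms(4)])
  \<comment> \<open>The weights are positive, so the bounds and the monotonicity of
    \<open>edge_gain\<close> pass to the sum term by term. As the energy is
    \<open>?MF - ?S \<alpha>\<close>, the inequalities reverse.\<close>
  have S_nonneg: "?S \<alpha> \<ge> 0" if "\<alpha> > 0" for \<alpha>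
    using that q by (intro sum_nonneg mult_nonneg_nonneg edge_gain_nonneg) (auto intro: less_imp_le)
  have S_mono: "?S \<alpha> \<le> ?S \<beta>" if "0 < \<alpha>" "\<alpha> \<le> \<beta>" for \<alpha> \<beta>
    using that q by (intro sum_mono mult_left_mono edge_gain_mono) (auto intro: less_imp_le)
  have S_le: "?S \<alpha> \<le> (\<Sum>e\<in>edges R. ?q e)" if "\<alpha> > 0" for \<alpha>
    using that q by (intro sum_mono mult_left_le edge_gain_le_1) (auto intro: less_imp_le)
  \<comment> \<open>The sum is finite, so limits are taken termwise. Positivity of the weight keeps
    the argument of \<open>edge_gain\<close> on the right of 0.\<close>
  have "(?S \<longlongrightarrow> (\<Sum>e\<in>edges R. ?q e * 0)) (at_right 0)"
  proof (intro tendsto_sum tendsto_mult tendsto_const)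
    fix e assume "e \<in> edges R"
    from q[OF this] have "filterlim (\<lambda>\<alpha>. 2 * \<alpha> * ?q e) (at_right 0) (at_right 0)"
      by real_asymp
    then show "((\<lambda>\<alpha>. edge_gain (2 * \<alpha> * ?q e)) \<longlongrightarrow> 0) (at_right 0)"
      by (rule filterlim_compose[OF edge_gain_tendsto_0])
  qed
  then have "((\<lambda>\<alpha>. ?MF - ?S \<alpha>) \<longlongrightarrow> ?MF - 0) (at_right 0)"
    by (intro tendsto_diff tendsto_const) simp
  \<comment> \<open>The formula \<open>F\<close> is available only for positive \<alpha>, which
    holds eventually along \<open>at_right 0\<close>.\<close>
  then have lim0: "(?F \<longlongrightarrow> ?MF) (at_right 0)"
    by (rule Lim_transform_eventually[rotated, THEN tendsto_eq_rhs, rotated])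
       (auto simp: F intro: eventually_at_right_less[THEN eventually_mono])
  have "(?S \<longlongrightarrow> (\<Sum>e\<in>edges R. ?q e * 1)) at_top"
  proof (intro tendsto_sum tendsto_mult tendsto_const)
    fix e assume "e \<in> edges R"
    from q[OF this] have "filterlim (\<lambda>\<alpha>. 2 * \<alpha> * ?q e) at_top at_top"
      by real_asymp
    then show "((\<lambda>\<alpha>. edge_gain (2 * \<alpha> * ?q e)) \<longlongrightarrow> 1) at_top"
      by (rule filterlim_compose[OF edge_gain_tendsto_1])
  qed
  then have "((\<lambda>\<alpha>. ?MF - ?S \<alpha>) \<longlongrightarrow> ?MF - 1/2 * (\<sigma> \<bullet> (abs_matrix R *v \<sigma>))) at_top"
    unfolding total[symmetric] by (intro tendsto_diff tendsto_const) simp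
  then have lim_top: "(?F \<longlongrightarrow> ?MF - 1/2 * (\<sigma> \<bullet> (abs_matrix R *v \<sigma>))) at_top"
    by (rule Lim_transform_eventually)
       (auto simp: F intro: eventually_gt_at_top[of 0, THEN eventually_mono])
  \<comment> \<open>At \<alpha> = 0 the value is a \<open>Lim\<close>; the convergence
    \<open>lim0\<close> identifies it by uniqueness of limits.\<close>
  have c0: "constrained_free_energy h J R C 0 m \<sigma> = ?MF"
    using tendsto_Lim[OF _ lim0] by (simp add: constrained_free_energy_def)
  have c: "constrained_free_energy h J R C \<alpha> m \<sigma> = ?MF - ?S \<alpha>" if "\<alpha> > 0" for \<alpha>
    using that F[OF that] by (simp add: constrained_free_energy_def)
  have B: "bethe_free_energy h J R C m (opt_cov R 1 \<sigma>) \<sigma> = ?MF - ?S 1"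
    unfolding bethe_free_energy_def by (rule F) simp
  have "?MF \<ge> constrained_free_energy h J R C \<alpha> m \<sigma> \<and>
      constrained_free_energy h J R C \<alpha> m \<sigma> \<ge> bethe_free_energy h J R C m (opt_cov R 1 \<sigma>) \<sigma>"
    if "0 \<le> \<alpha>" "\<alpha> \<le> 1" for \<alpha>
  \<comment> \<open>At 0 the first inequality is an equality and the second says that
    \<open>?S 1\<close> is nonnegative. For positive \<alpha> the second compares
    \<open>?S \<alpha>\<close> with \<open>?S 1\<close>.\<close>
  proof (cases "\<alpha> = 0")
    case True
    then show ?thesis using S_nonneg[of 1] unfolding B True c0 by simp
  next
    case False
    with that have "\<alpha> > 0" by simp
    then show ?thesis
      using S_nonneg[of \<alpha>] S_mono[of \<alpha> 1] that(2) unfolding B c[OF \<open>\<alpha> > 0\<close>] by simp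
  qed
  moreover have "bethe_free_energy h J R C m (opt_cov R 1 \<sigma>) \<sigma>
        \<ge> constrained_free_energy h J R C \<alpha> m \<sigma> \<and>
      constrained_free_energy h J R C \<alpha> m \<sigma> \<ge> ?MF - 1/2 * (\<sigma> \<bullet> (abs_matrix R *v \<sigma>))"
    if "\<alpha> \<ge> 1" for \<alpha>
  proof -
    from that have "\<alpha> > 0" by simp
    then show ?thesis
      using S_mono[of 1 \<alpha>] S_le[of \<alpha>] that unfolding B c[OF \<open>\<alpha> > 0\<close>] total[symmetric] by simp
  qed
  ultimately show ?thesis using lim0 lim_top by blast
qed

end
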